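(* Let $b,\rho\in\mathbb{C}$ with $\operatorname{Re}(\rho)>0$ and let $z\in\mathbb{C}\setminus(-\infty,0]$. (i) For $\nu,c\in\mathbb{C}$ with $\operatorname{Re}(\nu)>-\tfrac32$, $\operatorname{Re}(c)>\tfrac12$, $$\frac{\partial}{\partial z}\Big[z^{-\nu+\frac12}\frac{\partial}{\partial z}\big[z^{\nu+1}g_\nu^{(b,c-1)}(z;\rho)\big]\Big]=z^{\frac12}\big(c-\tfrac32\big)\,g_{\nu-1}^{(b,c)}(z;\rho).$$ (ii) For $\nu,\lambda\in\mathbb{C}$ with $\operatorname{Re}(\nu)>-1$, $\operatorname{Re}(\lambda)>0$, $$\frac{\partial}{\partial z}\Big[(\sqrt z)^{-\nu+2}\frac{\partial}{\partial z}\big[(\sqrt z)^{2\nu}C_\nu^{(b,\lambda-1)}(z;\rho)\big]\Big]=(\sqrt z)^{\nu-2}\,\frac{\lambda-1}2\,C_{\nu-1}^{(b,\lambda)}(z;\rho).$$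
   Context: For $\rho\in\mathbb{C}$ with $\operatorname{Re}(\rho)>0$ and $x\in\mathbb{C}$ put $\Gamma_\rho(x)=\int_0^\infty t^{x-1}e^{-t-\rho/t}\,dt$. The generalized Pochhammer symbol is $(\lambda;\rho)_\nu:=\Gamma_\rho(\lambda+\nu)/\Gamma(\lambda)$ for $\lambda,\nu\in\mathbb{C}$, where $1/\Gamma$ is read as an entire function (zero at $0,-1,-2,\dots$). The unified four parameter Bessel function is $G_\nu^{(b,c)}(z;\rho):=\sum_{k=0}^\infty \frac{(-b)^k (c;\rho)_{2k+\nu}}{\Gamma(\nu+k+1)\,\Gamma(\nu+2k+1)}\,\frac{(z/2)^{2k+\nu}}{k!}$. The generalized four parameter spherical Bessel and Bessel-Clifford functions are $$g_\nu^{(b,c)}(z;\rho):=\sqrt{\tfrac{\pi}{2z}}\,G_{\nu+\frac12}^{(b,c-\frac12)}(z;\rho)=\frac{\sqrt\pi}{2}\sum_{k=0}^\infty\frac{(-b)^k(c-\frac12;\rho)_{2k+\nu+\frac12}}{k!\,\Gamma(\nu+k+\frac32)\,\Gamma(\nu+2k+\frac32)}\Big(\frac z2\Big)^{2k+\nu},$$ $$C_\nu^{(b,\lambda)}(z;\rho):=z^{-\nu/2}G_\nu^{(b,\lambda)}(2\sqrt z;\rho)=\sum_{k=0}^\infty\frac{(-b)^k(\lambda;\rho)_{2k+\nu}}{k!\,\Gamma(\nu+k+1)\,\Gamma(\nu+2k+1)}\,z^k.$$ Functions with shifted parameters (including order $\nu-1$) are given by the same series. Powers and square roots are principal. *)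

theory Defs
  imports "HOL-Analysis.Analysis"
begin

definition ext_Gamma :: "complex \<Rightarrow> complex \<Rightarrow> complex" where
  "ext_Gamma \<rho> x =
     (LBINT t:{0<..}. of_real t powr (x - 1) * exp (- of_real t - \<rho> / of_real t))"

text \<open>The library's \<open>rGamma\<close> is the entire function $1/\Gamma$, vanishing at $0,-1,-2,\dots$\<close>

definition ext_pochhammer :: "complex \<Rightarrow> complex \<Rightarrow> complex \<Rightarrow> complex" where
  "ext_pochhammer a \<rho> \<nu> = ext_Gamma \<rho> (a + \<nu>) * rGamma a"

definition bessel4 :: "complex \<Rightarrow> complex \<Rightarrow> complex \<Rightarrow> complex \<Rightarrow> complex \<Rightarrow> complex" where
  "bessel4 b c \<rho> \<nu> z =
     (\<Sum>k. (- b) ^ k * ext_pochhammer c \<rho> (2 * of_nat k + \<nu>)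
            * rGamma (\<nu> + of_nat k + 1) * rGamma (\<nu> + 2 * of_nat k + 1)
            * (z / 2) powr (2 * of_nat k + \<nu>) / fact k)"

text \<open>Complex \<open>powr\<close> and \<open>csqrt\<close> are the principal branches. As \<open>0 powr a = 0\<close>, the values
  at \<open>z = 0\<close> of the functions here are meaningless; they are only used off \<open>\<real>\<^sub>\<le>\<^sub>0\<close>.\<close>

definition spherical_bessel4 :: "complex \<Rightarrow> complex \<Rightarrow> complex \<Rightarrow> complex \<Rightarrow> complex \<Rightarrow> complex" where
  "spherical_bessel4 b c \<rho> \<nu> z =
     csqrt (of_real pi / (2 * z)) * bessel4 b (c - 1/2) \<rho> (\<nu> + 1/2) z"

definition bessel_clifford4 :: "complex \<Rightarrow> complex \<Rightarrow> complex \<Rightarrow> complex \<Rightarrow> complex \<Rightarrow> complex" where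
  "bessel_clifford4 b l \<rho> \<nu> z = z powr (- \<nu> / 2) * bessel4 b l \<rho> \<nu> (2 * csqrt z)"

end

theory Submission
  imports Defs "HOL-Real_Asymp.Real_Asymp"
begin

text \<open>
  Up to a constant, each of the two functions differentiated here is, on the slit plane, a
  power \<open>w\<^sup>\<alpha>\<close> times an entire function \<open>\<Sum>k. a\<^sub>k w\<^bsup>mk\<^esup>\<close> built from the Bessel coefficients, with
  \<open>m = 2\<close>, \<open>\<alpha> = 2\<nu> + 1\<close> in the spherical case and \<open>m = 1\<close>, \<open>\<alpha> = \<nu>\<close> in the Clifford case.
  On a single power \<open>w\<^bsup>\<alpha>+mk\<^esup>\<close> the operator \<open>F \<mapsto> (w\<^sup>\<beta> F')'\<close> produces the factor
  \<open>(\<alpha> + mk)(\<alpha> + \<beta> - 1 + mk)\<close>. The exponents \<open>\<beta>\<close> are chosen such that this factor is a constant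
  times \<open>(\<mu> + k)(\<mu> + 2k)\<close>, where \<open>\<mu>\<close> is the order of the underlying Bessel series. These are the
  factors that \<open>1/\<Gamma>(s) = s/\<Gamma>(s + 1)\<close> absorbs into \<open>1/\<Gamma>(\<mu>+k+1)\<close> and \<open>1/\<Gamma>(\<mu>+2k+1)\<close>, so that the order
  drops by one. The numerator \<open>\<Gamma>\<^sub>\<rho>(c - 1 + 2k + \<mu>)\<close> depends only on the sum of \<open>c - 1\<close> and \<open>\<mu>\<close>,
  hence it may equally be read as belonging to the parameter \<open>c\<close> and the order \<open>\<mu> - 1\<close>; the
  normalising \<open>1/\<Gamma>(c - 1)\<close> then yields the factor \<open>c - 1\<close>. This is \<open>bessel4_coeff_lower_order\<close>.

  The analytic content is the right to differentiate term by term, which needs the series of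
  coefficients to converge everywhere (\<open>summable_bessel4_coeff\<close>). Because
  \<open>\<bar>\<Gamma>\<^sub>\<rho>(x)\<bar> \<le> \<Gamma>(Re x)\<close> once \<open>Re x > 0\<close>, the growth of the numerator is compensated by
  \<open>1/\<Gamma>(\<mu>+2k+1)\<close>, and the two remaining factors \<open>1/\<Gamma>(\<mu>+k+1)\<close> and \<open>1/k!\<close> leave terms of size about
  \<open>r\<^sup>k/(k!)\<^sup>2\<close>.
\<close>

section \<open>The coefficients of the Bessel series\<close>

text \<open>On the positive axis \<open>\<bar>exp (- \<rho>/t)\<bar> \<le> 1\<close>, so the integrand is dominated by that of Euler's
  integral for \<open>\<Gamma>(Re x)\<close>.\<close>

lemma norm_ext_Gamma_le:
  assumes "Re \<rho> \<ge> 0" and "Re x > 0"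
  shows "norm (ext_Gamma \<rho> x) \<le> Gamma (Re x)"
proof -
  define f :: "real \<Rightarrow> complex" where
    "f = (\<lambda>t. indicat_real {0<..} t *\<^sub>R (of_real t powr (x - 1) * exp (- of_real t - \<rho> / of_real t)))"
  have eq: "ext_Gamma \<rho> x = integral\<^sup>L lborel f"
    by (simp add: ext_Gamma_def f_def set_lebesgue_integral_def)
  have pointwise: "norm (f t) \<le> indicator {0..} t * t powr (Re x - 1) / exp t" for t
  proof (cases "t > 0")
    case True
    have "Re (\<rho> / of_real t) \<ge> 0"
      using True assms(1) by simp
    then have "t powr (Re x - 1) * exp (- t - Re (\<rho> / of_real t)) \<le> t powr (Re x - 1) * exp (- t)"
      by (intro mult_left_mono) auto
    moreover have "norm (f t) = t powr (Re x - 1) * exp (- t - Re (\<rho> / of_real t))"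
      using True by (simp add: f_def norm_mult norm_powr_real_powr)
    ultimately show ?thesis
      using True by (simp add: exp_minus divide_inverse)
  qed (auto simp: f_def)
  show ?thesis
    \<comment> \<open>A Bochner integral of a non-integrable function is zero, which satisfies the bound as well.\<close>
  proof (cases "integrable lborel f")
    case True
    have "ennreal (norm (integral\<^sup>L lborel f)) \<le> (\<integral>\<^sup>+t. norm (f t) \<partial>lborel)"
      using True by (rule integral_norm_bound_ennreal)
    also have "\<dots> \<le> (\<integral>\<^sup>+t. ennreal (indicator {0..} t * t powr (Re x - 1) / exp t) \<partial>lborel)"
      by (intro nn_integral_mono ennreal_leI pointwise)
    also have "\<dots> = Gamma (Re x)"
      using Gamma_conv_nn_integral_real[OF assms(2)] by simp
    finally show ?thesis
      using assms(2) by (simp add: eq Gamma_real_pos less_imp_le)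
  next
    case False
    then show ?thesis
      using assms(2) by (simp add: eq not_integrable_integral_eq Gamma_real_pos less_imp_le)
  qed
qed

text \<open>With the powers of \<open>z\<close> stripped off, the Bessel function is a power times an entire function
  of \<open>(z/2)\<^sup>2\<close> with these coefficients.\<close>

definition bessel4_coeff ::
  "complex \<Rightarrow> complex \<Rightarrow> complex \<Rightarrow> complex \<Rightarrow> nat \<Rightarrow> complex" where
  "bessel4_coeff b c \<rho> \<nu> k =
     (- b) ^ k * ext_pochhammer c \<rho> (2 * of_nat k + \<nu>)
       * rGamma (\<nu> + of_nat k + 1) * rGamma (\<nu> + 2 * of_nat k + 1) / fact k"

text \<open>The recurrence \<open>z/\<Gamma>(z + 1) = 1/\<Gamma>(z)\<close> in the form that a ratio test consumes.\<close>

lemma norm_rGamma_plus1_le: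
  fixes z :: complex
  assumes "0 < r" and "r \<le> norm z"
  shows "norm (rGamma (z + 1)) \<le> norm (rGamma z) / r"
proof -
  have "norm (rGamma z) = norm z * norm (rGamma (z + 1))"
    by (metis norm_mult rGamma_plus1)
  also have "\<dots> \<ge> r * norm (rGamma (z + 1))"
    using assms by (intro mult_right_mono) auto
  finally show ?thesis
    using assms by (simp add: field_simps)
qed

text \<open>The ratio test is applied to the majorant obtained by replacing \<open>\<Gamma>\<^sub>\<rho>\<close> with the real Gamma
  function: the functional equations of \<open>\<Gamma>\<close> and \<open>1/\<Gamma>\<close> bound the quotient of consecutive terms by
  a rational function of \<open>k\<close> whose denominator has degree four and whose numerator has degree two.\<close>

lemma summable_bessel4_coeff:
  assumes "Re \<rho> \<ge> 0"
  shows "summable (\<lambda>k. bessel4_coeff b c \<rho> \<nu> k * x ^ k)"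
proof -
  define \<sigma> where "\<sigma> = Re (c + \<nu>)"
  define n where "n = norm \<nu>"
  define B where "B = norm b * norm x"
  define M :: "nat \<Rightarrow> real" where
    "M = (\<lambda>k. B ^ k * (Gamma (\<sigma> + 2 * real k) * norm (rGamma c))
               * norm (rGamma (\<nu> + of_nat k + 1)) * norm (rGamma (\<nu> + 2 * of_nat k + 1)) / fact k)"
  have B: "B \<ge> 0" by (simp add: B_def)
  \<comment> \<open>The bound on \<open>\<Gamma>\<^sub>\<rho>\<close> and the positivity of the denominators below hold only for large \<open>k\<close>.\<close>
  have ev1: "\<forall>\<^sub>F k::nat in sequentially. \<sigma> + 2 * real k > 0 \<and> real k + 1 > n"
    by (intro eventually_conj; real_asymp)
  have ev2: "\<forall>\<^sub>F k::nat in sequentially.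
      B * ((\<sigma> + 2 * real k + 1) * (\<sigma> + 2 * real k))
        / ((real k + 1 - n) * (2 * real k + 1 - n) * (2 * real k + 2 - n) * (real k + 1)) < 1 / 2"
    by real_asymp
  have "\<forall>\<^sub>F k in sequentially. norm (M (Suc k)) \<le> 1 / 2 * norm (M k)"
    using ev1 ev2
  proof eventually_elim
    case (elim k)
    define q where "q = (real k + 1 - n) * (2 * real k + 1 - n) * (2 * real k + 2 - n) * (real k + 1)"
    have pos: "real k + 1 - n > 0" "2 * real k + 1 - n > 0" "2 * real k + 2 - n > 0"
      using elim by auto
    have lower: "real m - n \<le> norm (\<nu> + of_nat m)" for m
      using norm_diff_ineq[of "of_nat m" \<nu>] by (simp add: n_def add.commute)
    have G: "Gamma (\<sigma> + 2 * Suc k) = (\<sigma> + 2 * real k + 1) * (\<sigma> + 2 * real k) * Gamma (\<sigma> + 2 * real k)"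
      using elim Gamma_plus1[of "\<sigma> + 2 * real k + 1"] Gamma_plus1[of "\<sigma> + 2 * real k"]
      by (auto simp: algebra_simps nonpos_Ints_def)
    have R1: "norm (rGamma (\<nu> + of_nat (Suc k) + 1)) \<le> norm (rGamma (\<nu> + of_nat k + 1)) / (real k + 1 - n)"
      using norm_rGamma_plus1_le[OF pos(1), of "\<nu> + of_nat k + 1"] lower[of "k + 1"]
      by (simp add: algebra_simps)
    have "norm (rGamma (\<nu> + 2 * of_nat (Suc k) + 1))
            \<le> norm (rGamma (\<nu> + 2 * of_nat k + 2)) / (2 * real k + 2 - n)"
      using norm_rGamma_plus1_le[OF pos(3), of "\<nu> + 2 * of_nat k + 2"] lower[of "2 * k + 2"]
      by (simp add: algebra_simps)
    also have "\<dots> \<le> norm (rGamma (\<nu> + 2 * of_nat k + 1)) / (2 * real k + 1 - n) / (2 * real k + 2 - n)"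
      using norm_rGamma_plus1_le[OF pos(2), of "\<nu> + 2 * of_nat k + 1"] lower[of "2 * k + 1"] pos
      by (intro divide_right_mono) (simp_all add: algebra_simps)
    finally have R2: "norm (rGamma (\<nu> + 2 * of_nat (Suc k) + 1))
       \<le> norm (rGamma (\<nu> + 2 * of_nat k + 1)) / (2 * real k + 1 - n) / (2 * real k + 2 - n)" .
    have Gk: "Gamma (\<sigma> + 2 * real k) > 0"
      using elim by (intro Gamma_real_pos) auto
    have Mk: "M k \<ge> 0"
      using Gk B by (simp add: M_def)
    have "M (Suc k) \<le> B ^ Suc k * (Gamma (\<sigma> + 2 * Suc k) * norm (rGamma c))
               * (norm (rGamma (\<nu> + of_nat k + 1)) / (real k + 1 - n))
               * (norm (rGamma (\<nu> + 2 * of_nat k + 1)) / (2 * real k + 1 - n) / (2 * real k + 2 - n))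
               / fact (Suc k)"
      unfolding M_def using B R1 R2 Gk elim pos
      by (intro divide_right_mono mult_mono) (auto simp: G intro!: mult_nonneg_nonneg)
    also have "\<dots> = B * ((\<sigma> + 2 * real k + 1) * (\<sigma> + 2 * real k)) / q * M k"
      unfolding G M_def q_def by (simp add: field_simps)
    also have "\<dots> \<le> 1 / 2 * M k"
      unfolding q_def using elim(2) Mk by (intro mult_right_mono[OF less_imp_le])
    finally have "M (Suc k) \<le> 1 / 2 * M k" .
    moreover have "M (Suc k) \<ge> 0"
      unfolding M_def G using Gk B elim by (auto intro!: mult_nonneg_nonneg divide_nonneg_nonneg)
    ultimately show ?case using Mk by simp
  qed
  then obtain N where "\<And>k. k \<ge> N \<Longrightarrow> norm (M (Suc k)) \<le> 1 / 2 * norm (M k)"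
    by (auto simp: eventually_sequentially)
  then have "summable M"
    by (intro summable_ratio_test[of "1 / 2" N]) auto
  moreover have "\<forall>\<^sub>F k in sequentially. norm (bessel4_coeff b c \<rho> \<nu> k * x ^ k) \<le> M k"
    using ev1
  proof eventually_elim
    case (elim k)
    have "norm (ext_Gamma \<rho> (c + (2 * of_nat k + \<nu>))) \<le> Gamma (\<sigma> + 2 * real k)"
      using norm_ext_Gamma_le[OF assms, of "c + (2 * of_nat k + \<nu>)"] elim
      by (simp add: \<sigma>_def add_ac)
    then have "norm (b ^ k * x ^ k) * (norm (ext_Gamma \<rho> (c + (2 * of_nat k + \<nu>))) * norm (rGamma c))
             * norm (rGamma (\<nu> + of_nat k + 1)) * norm (rGamma (\<nu> + 2 * of_nat k + 1)) / fact k
       \<le> norm (b ^ k * x ^ k) * (Gamma (\<sigma> + 2 * real k) * norm (rGamma c))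
             * norm (rGamma (\<nu> + of_nat k + 1)) * norm (rGamma (\<nu> + 2 * of_nat k + 1)) / fact k"
      by (intro divide_right_mono mult_right_mono mult_left_mono) auto
    then show ?case
      by (simp add: bessel4_coeff_def M_def B_def ext_pochhammer_def norm_mult norm_divide
            norm_power power_mult_distrib mult_ac)
  qed
  ultimately show ?thesis
    by (rule summable_comparison_test_ev[rotated])
qed

text \<open>The two linear factors are absorbed by the reciprocal Gamma functions, which lowers the order,
  while \<open>\<Gamma>\<^sub>\<rho>\<close> only sees the sum of parameter and order, so the parameter goes up in exchange.\<close>

lemma bessel4_coeff_lower_order:
  "(\<nu> + of_nat k) * (\<nu> + 2 * of_nat k) * bessel4_coeff b (c - 1) \<rho> \<nu> k
     = (c - 1) * bessel4_coeff b c \<rho> (\<nu> - 1) k"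
proof -
  have 1: "(\<nu> + of_nat k) * rGamma (\<nu> + of_nat k + 1) = rGamma (\<nu> - 1 + of_nat k + 1)"
    and 2: "(\<nu> + 2 * of_nat k) * rGamma (\<nu> + 2 * of_nat k + 1) = rGamma (\<nu> - 1 + 2 * of_nat k + 1)"
    and 3: "rGamma (c - 1) = (c - 1) * rGamma c"
    using rGamma_plus1[of "\<nu> + of_nat k"] rGamma_plus1[of "\<nu> + 2 * of_nat k"] rGamma_plus1[of "c - 1"]
    by (simp_all add: algebra_simps)
  have 4: "c - 1 + (2 * of_nat k + \<nu>) = c + (2 * of_nat k + (\<nu> - 1))"
    by simp
  show ?thesis
    unfolding bessel4_coeff_def ext_pochhammer_def 3 4 1[symmetric] 2[symmetric] by simp
qed

section \<open>Power series forms on the slit plane\<close>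

lemma complex_powr_mult_even_nat:
  fixes w :: complex
  assumes "w \<noteq> 0"
  shows "w powr (2 * of_nat k + a) = w powr a * (w\<^sup>2) ^ k"
  using powr_nat[of w "2 * k"] assms by (simp add: powr_add power_mult)

lemma bessel4_eq:
  assumes "Re \<rho> \<ge> 0" and "z \<noteq> 0"
  shows "bessel4 b c \<rho> \<nu> z = (z / 2) powr \<nu> * (\<Sum>k. bessel4_coeff b c \<rho> \<nu> k * ((z / 2)\<^sup>2) ^ k)"
proof -
  have "bessel4 b c \<rho> \<nu> z
      = (\<Sum>k. (z / 2) powr \<nu> * (bessel4_coeff b c \<rho> \<nu> k * ((z / 2)\<^sup>2) ^ k))"
    unfolding bessel4_def bessel4_coeff_def using assms(2)
    by (intro suminf_cong, subst complex_powr_mult_even_nat) auto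
  then show ?thesis
    using suminf_mult[OF summable_bessel4_coeff[OF assms(1)]] by simp
qed

text \<open>No branch correction is needed: the argument of \<open>csqrt w\<close> lies in \<open>(-\<pi>/2, \<pi>/2]\<close>. Thus every
  power of \<open>csqrt\<close> can be treated as a power of \<open>w\<close>.\<close>

lemma csqrt_powr: "csqrt w powr a = w powr (a / 2)"
proof (cases "w = 0")
  case False
  have "csqrt w = exp (Ln w / 2)"
    using False csqrt_exp_Ln by blast
  moreover have "Ln (exp (Ln w / 2)) = Ln w / 2"
    using mpi_less_Im_Ln[OF False] Im_Ln_le_pi[OF False] by (intro Ln_exp) auto
  ultimately have Ln_csqrt: "Ln (csqrt w) = Ln w / 2"
    by simp
  show ?thesis
    using False by (simp add: powr_def Ln_csqrt)
qed auto

lemma bessel_clifford4_eq: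
  assumes "Re \<rho> \<ge> 0" and "z \<noteq> 0"
  shows "bessel_clifford4 b l \<rho> \<nu> z = (\<Sum>k. bessel4_coeff b l \<rho> \<nu> k * z ^ k)"
proof -
  have "bessel4 b l \<rho> \<nu> (2 * csqrt z) = z powr (\<nu> / 2) * (\<Sum>k. bessel4_coeff b l \<rho> \<nu> k * z ^ k)"
    using assms by (subst bessel4_eq) (auto simp: csqrt_powr)
  moreover have "z powr (- \<nu> / 2) * z powr (\<nu> / 2) = 1"
    using assms(2) by (simp flip: powr_add)
  ultimately show ?thesis
    by (simp add: bessel_clifford4_def flip: mult.assoc)
qed

text \<open>Off the negative real axis \<open>Ln (1/z) = - Ln z\<close>, so the prefactor \<open>csqrt (\<pi>/(2z))\<close> is
  \<open>sqrt \<pi> / 2\<close> times \<open>(z/2)\<^bsup>-1/2\<^esup>\<close>, and it cancels the half in the order \<open>\<nu> + 1/2\<close>.\<close>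

lemma spherical_bessel4_eq:
  assumes "Re \<rho> \<ge> 0" and z: "z \<notin> \<real>\<^sub>\<le>\<^sub>0"
  shows "spherical_bessel4 b c \<rho> \<nu> z = of_real (sqrt pi) / 2 * 2 powr (- \<nu>) * z powr \<nu> *
           (\<Sum>k. bessel4_coeff b (c - 1/2) \<rho> (\<nu> + 1/2) k / 4 ^ k * z ^ (2 * k))"
proof -
  have z0: "z \<noteq> 0" using z by auto
  have inv: "csqrt (of_real pi / (2 * z)) = of_real (sqrt pi) * (z / 2) powr (-1/2) / 2"
  proof -
    have L2: "Ln (z / 2) = Ln z - of_real (ln 2)"
      using Ln_divide_of_real[of 2 z] z0 by simp
    have "of_real pi / (2 * z) = of_real (pi / 2) * inverse z"
      by (simp add: field_simps)
    moreover have "Ln (of_real (pi / 2) * inverse z) = Ln (of_real (pi / 2)) + Ln (inverse z)"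
      by (rule Ln_times_of_real) (use z0 in auto)
    moreover have "Ln (of_real (pi / 2)) = of_real (ln (pi / 2))"
      by (rule Ln_of_real) auto
    ultimately have "Ln (of_real pi / (2 * z)) = of_real (ln (pi / 2)) - Ln z"
      by (simp only: Ln_inverse[OF z] diff_conv_add_uminus)
    then have "csqrt (of_real pi / (2 * z)) = exp ((of_real (ln (pi / 2)) - Ln z) / 2)"
      using z0 by (subst csqrt_exp_Ln) auto
    also have "(of_real (ln (pi / 2)) - Ln z) / 2
        = of_real (ln pi / 2) + (- 1/2) * Ln (z / 2) - of_real (ln 2)"
      by (simp add: L2 ln_div field_simps)
    also have "exp \<dots> = of_real (sqrt pi) * (z / 2) powr (-1/2) / 2"
    proof -
      have "exp (complex_of_real (ln pi / 2)) = of_real (sqrt pi)"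
      proof -
        have "ln pi / 2 = ln (sqrt pi)" by (simp add: ln_sqrt)
        then show ?thesis by (simp only: exp_of_real exp_ln[OF real_sqrt_gt_zero[OF pi_gt_zero]])
      qed
      moreover have "exp (complex_of_real (ln 2)) = 2"
        unfolding exp_of_real by simp
      ultimately show ?thesis
        using z0 unfolding powr_def exp_add exp_diff by simp
    qed
    finally show ?thesis .
  qed
  have half: "(z / 2) powr \<nu> = 2 powr (- \<nu>) * z powr \<nu>"
  proof -
    have "Ln (z / 2) = Ln z - Ln 2"
      using Ln_divide_of_real[of 2 z] z0 Ln_of_real[of 2] by simp
    then have "\<nu> * Ln (z / 2) = - \<nu> * Ln 2 + \<nu> * Ln z"
      by (simp only:) (simp add: algebra_simps)
    then show ?thesis
      using z0 unfolding powr_def by (simp only: exp_add) simp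
  qed
  have "(z / 2) powr (-1/2) * (z / 2) powr (\<nu> + 1/2) = (z / 2) powr \<nu>"
    by (simp flip: powr_add)
  moreover have "((z / 2)\<^sup>2) ^ k = z ^ (2 * k) / 4 ^ k" for k
    by (simp add: power_divide power_mult)
  ultimately show ?thesis
    using assms z0 by (simp add: spherical_bessel4_def bessel4_eq inv half[symmetric])
qed

section \<open>Termwise differentiation of a power times an entire function\<close>

text \<open>The step \<open>m\<close> lets the same rule serve series in \<open>w\<close> and in \<open>w\<^sup>2\<close>. The second part says
  that the new coefficients again define an entire function, so that the rule can be iterated.\<close>

lemma has_field_derivative_powr_times_power_series:
  fixes a :: "nat \<Rightarrow> complex"
  assumes a: "\<And>x. summable (\<lambda>k. a k * x ^ k)" and z: "z \<notin> \<real>\<^sub>\<le>\<^sub>0"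
  shows "((\<lambda>w. w powr \<alpha> * (\<Sum>k. a k * w ^ (m * k))) has_field_derivative
           z powr (\<alpha> - 1) * (\<Sum>k. (\<alpha> + of_nat (m * k)) * a k * z ^ (m * k))) (at z)" (is ?deriv)
    and "summable (\<lambda>k. (\<alpha> + of_nat (m * k)) * a k * x ^ k)" (is ?summable)
proof -
  have z0: "z \<noteq> 0" using z by auto
  define f where "f = (\<lambda>x. \<Sum>k. a k * x ^ k)"
  define d where "d = (\<lambda>x. \<Sum>k. diffs a k * x ^ k)"
  have f: "(f has_field_derivative d x) (at x)" for x
    unfolding f_def d_def by (rule termdiffs_strong_converges_everywhere[OF a])
  \<comment> \<open>The Euler operator \<open>x d/dx\<close> multiplies the \<open>k\<close>-th coefficient by \<open>k\<close> without shifting the index.\<close>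
  have euler: "(\<lambda>k. of_nat k * a k * x ^ k) sums (x * d x)" for x
  proof -
    have "(\<lambda>k. x * (diffs a k * x ^ k)) sums (x * d x)"
      unfolding d_def by (intro sums_mult summable_sums termdiff_converges_all a)
    then have "(\<lambda>k. of_nat (Suc k) * a (Suc k) * x ^ Suc k) sums (x * d x)"
      by (simp add: diffs_def mult_ac)
    then show ?thesis
      using sums_Suc[of "\<lambda>k. of_nat k * a k * x ^ k"] by simp
  qed
  have sums: "(\<lambda>k. (\<alpha> + of_nat (m * k)) * a k * x ^ k) sums (\<alpha> * f x + of_nat m * (x * d x))" for x
  proof -
    have "(\<lambda>k. \<alpha> * (a k * x ^ k) + of_nat m * (of_nat k * a k * x ^ k)) sums
            (\<alpha> * f x + of_nat m * (x * d x))"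
      unfolding f_def by (intro sums_add sums_mult euler summable_sums a)
    then show ?thesis by (simp add: algebra_simps)
  qed
  then show ?summable by (auto simp: sums_iff)
  have "((\<lambda>w. w powr \<alpha> * f (w ^ m)) has_field_derivative
          (\<alpha> * z powr (\<alpha> - 1)) * f (z ^ m) + z powr \<alpha> * (d (z ^ m) * (of_nat m * z ^ (m - 1)))) (at z)"
    using z0 z
    by (auto intro!: derivative_eq_intros DERIV_chain2[OF f] simp: powr_diff field_simps)
  also have "(\<alpha> * z powr (\<alpha> - 1)) * f (z ^ m) + z powr \<alpha> * (d (z ^ m) * (of_nat m * z ^ (m - 1)))
     = z powr (\<alpha> - 1) * (\<alpha> * f (z ^ m) + of_nat m * (z ^ m * d (z ^ m)))"
    using z0 by (cases m) (simp_all add: powr_diff field_simps)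
  also have "\<alpha> * f (z ^ m) + of_nat m * (z ^ m * d (z ^ m))
     = (\<Sum>k. (\<alpha> + of_nat (m * k)) * a k * z ^ (m * k))"
    using sums_unique[OF sums[of "z ^ m"]] by (simp add: power_mult)
  finally show ?deriv
    by (simp add: f_def power_mult)
qed

text \<open>The identity for \<open>F\<close> is assumed on the whole slit plane and not just at \<open>z\<close>, since the
  second differentiation needs the values of \<open>deriv F\<close> in a neighbourhood of \<open>z\<close>.\<close>

lemma iterated_derivative_powr_times_power_series:
  fixes a :: "nat \<Rightarrow> complex"
  assumes a: "\<And>x. summable (\<lambda>k. a k * x ^ k)" and z: "z \<notin> \<real>\<^sub>\<le>\<^sub>0"
    and F: "\<And>w. w \<notin> \<real>\<^sub>\<le>\<^sub>0 \<Longrightarrow> F w = K * (w powr \<alpha> * (\<Sum>k. a k * w ^ (m * k)))"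
  shows "F field_differentiable at z"
    and "((\<lambda>w. w powr \<beta> * deriv F w) has_field_derivative
           K * (z powr (\<alpha> + \<beta> - 2) *
             (\<Sum>k. (\<alpha> + \<beta> - 1 + of_nat (m * k)) * ((\<alpha> + of_nat (m * k)) * a k) * z ^ (m * k)))) (at z)"
proof -
  have slit: "open (- \<real>\<^sub>\<le>\<^sub>0 :: complex set)"
    by (simp add: closed_nonpos_Reals_complex open_Compl)
  have F': "(F has_field_derivative
      K * (w powr (\<alpha> - 1) * (\<Sum>k. (\<alpha> + of_nat (m * k)) * a k * w ^ (m * k)))) (at w)"
    if w: "w \<notin> \<real>\<^sub>\<le>\<^sub>0" for w
    by (rule has_field_derivative_transform_within_open
          [OF DERIV_cmult[OF has_field_derivative_powr_times_power_series(1)[OF a w]] slit])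
       (use w F in auto)
  show "F field_differentiable at z"
    using F'[OF z] by (auto simp: field_differentiable_def)
  have "((\<lambda>w. K * (w powr (\<alpha> + \<beta> - 1) * (\<Sum>k. ((\<alpha> + of_nat (m * k)) * a k) * w ^ (m * k))))
      has_field_derivative
      K * (z powr (\<alpha> + \<beta> - 1 - 1) *
        (\<Sum>k. (\<alpha> + \<beta> - 1 + of_nat (m * k)) * ((\<alpha> + of_nat (m * k)) * a k) * z ^ (m * k)))) (at z)"
    by (intro DERIV_cmult has_field_derivative_powr_times_power_series(1) z
          has_field_derivative_powr_times_power_series(2)[OF a z])
  then have "((\<lambda>w. w powr \<beta> * deriv F w) has_field_derivative
      K * (z powr (\<alpha> + \<beta> - 1 - 1) *
        (\<Sum>k. (\<alpha> + \<beta> - 1 + of_nat (m * k)) * ((\<alpha> + of_nat (m * k)) * a k) * z ^ (m * k)))) (at z)"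
  proof (rule has_field_derivative_transform_within_open[OF _ slit])
    fix w :: complex
    assume "w \<in> - \<real>\<^sub>\<le>\<^sub>0"
    then have "deriv F w = K * (w powr (\<alpha> - 1) * (\<Sum>k. (\<alpha> + of_nat (m * k)) * a k * w ^ (m * k)))"
      using F' DERIV_imp_deriv by blast
    moreover have "w powr (\<alpha> + \<beta> - 1) = w powr \<beta> * w powr (\<alpha> - 1)"
      by (simp add: algebra_simps flip: powr_add)
    ultimately show "K * (w powr (\<alpha> + \<beta> - 1) * (\<Sum>k. ((\<alpha> + of_nat (m * k)) * a k) * w ^ (m * k)))
        = w powr \<beta> * deriv F w"
      by simp
  qed (use z in auto)
  then show "((\<lambda>w. w powr \<beta> * deriv F w) has_field_derivative
           K * (z powr (\<alpha> + \<beta> - 2) *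
             (\<Sum>k. (\<alpha> + \<beta> - 1 + of_nat (m * k)) * ((\<alpha> + of_nat (m * k)) * a k) * z ^ (m * k)))) (at z)"
    by (simp add: algebra_simps)
qed

section \<open>Lowering the order\<close>

text \<open>With \<open>\<alpha> = 2\<nu> + 1\<close> and \<open>\<beta> = 1/2 - \<nu>\<close> the factors are \<open>\<alpha> + 2k = 2(\<mu> + k)\<close> and
  \<open>\<alpha> + \<beta> - 1 + 2k = \<mu> + 2k\<close> for the Bessel order \<open>\<mu> = \<nu> + 1/2\<close>. The extra 2 is the quotient
  of the constants \<open>2\<^bsup>1-\<nu>\<^esup>\<close> and \<open>2\<^bsup>-\<nu>\<^esup>\<close> in front of the series of orders \<open>\<nu> - 1\<close> and \<open>\<nu>\<close>.\<close>

lemma spherical_bessel4_order_lowering: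
  fixes b c \<nu> :: complex
  assumes \<rho>: "Re \<rho> \<ge> 0" and z: "z \<notin> \<real>\<^sub>\<le>\<^sub>0"
  defines "F \<equiv> \<lambda>w. w powr (\<nu> + 1) * spherical_bessel4 b (c - 1) \<rho> \<nu> w"
  shows "F field_differentiable at z"
    and "((\<lambda>w. w powr (- \<nu> + 1/2) * deriv F w) has_field_derivative
           z powr (1/2) * (c - 3/2) * spherical_bessel4 b c \<rho> (\<nu> - 1) z) (at z)"
proof -
  define K :: complex where "K = of_real (sqrt pi) / 2 * 2 powr (- \<nu>)"
  define A where "A = bessel4_coeff b (c - 3/2) \<rho> (\<nu> + 1/2)"
  define A' where "A' = bessel4_coeff b (c - 1/2) \<rho> (\<nu> - 1/2)"
  have A: "summable (\<lambda>k. A k / 4 ^ k * x ^ k)" for x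
    using summable_bessel4_coeff[OF \<rho>, of b "c - 3/2" "\<nu> + 1/2" "x / 4"]
    by (simp add: A_def power_divide)
  have A': "summable (\<lambda>k. A' k / 4 ^ k * z ^ (2 * k))"
    using summable_bessel4_coeff[OF \<rho>, of b "c - 1/2" "\<nu> - 1/2" "z\<^sup>2 / 4"]
    by (simp add: A'_def power_divide power_mult)
  have F: "F w = K * (w powr (2 * \<nu> + 1) * (\<Sum>k. A k / 4 ^ k * w ^ (2 * k)))" if "w \<notin> \<real>\<^sub>\<le>\<^sub>0" for w
  proof -
    have "w powr (2 * \<nu> + 1) = w powr (\<nu> + 1) * w powr \<nu>"
      by (simp add: algebra_simps flip: powr_add)
    then show ?thesis
      using spherical_bessel4_eq[OF \<rho> that, of b "c - 1" \<nu>] by (simp add: F_def K_def A_def)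
  qed
  note D = iterated_derivative_powr_times_power_series[where a = "\<lambda>k. A k / 4 ^ k", OF A z F]
  show "F field_differentiable at z" by (rule D(1))
  have coeff: "(2 * \<nu> + 1 + (- \<nu> + 1/2) - 1 + of_nat (2 * k)) * ((2 * \<nu> + 1 + of_nat (2 * k)) * (A k / 4 ^ k))
       = 2 * (c - 3/2) * (A' k / 4 ^ k)" for k
  proof -
    have outer: "2 * \<nu> + 1 + (- \<nu> + 1/2) - 1 + of_nat (2 * k) = \<nu> + 1/2 + 2 * of_nat k"
      and inner: "2 * \<nu> + 1 + of_nat (2 * k) = 2 * (\<nu> + 1/2 + of_nat k)"
      by (simp_all add: algebra_simps)
    have lower: "(\<nu> + 1/2 + of_nat k) * (\<nu> + 1/2 + 2 * of_nat k) * A k = (c - 3/2) * A' k"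
      using bessel4_coeff_lower_order[of "\<nu> + 1/2" k b "c - 1/2" \<rho>] by (simp add: A_def A'_def)
    have "(\<nu> + 1/2 + 2 * of_nat k) * (2 * (\<nu> + 1/2 + of_nat k) * (A k / 4 ^ k))
        = 2 * ((\<nu> + 1/2 + of_nat k) * (\<nu> + 1/2 + 2 * of_nat k) * A k) / 4 ^ k"
      by (simp only: mult_ac times_divide_eq_right times_divide_eq_left)
    then show ?thesis
      unfolding outer inner lower by simp
  qed
  have "K * (z powr (2 * \<nu> + 1 + (- \<nu> + 1/2) - 2) *
      (\<Sum>k. (2 * \<nu> + 1 + (- \<nu> + 1/2) - 1 + of_nat (2 * k)) * ((2 * \<nu> + 1 + of_nat (2 * k)) * (A k / 4 ^ k)) * z ^ (2 * k)))
    = K * (z powr (\<nu> - 1/2) * (2 * (c - 3/2) * (\<Sum>k. A' k / 4 ^ k * z ^ (2 * k))))"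
  proof -
    have "2 * \<nu> + 1 + (- \<nu> + 1/2) - 2 = \<nu> - 1/2"
      by (simp add: algebra_simps)
    moreover have "(\<Sum>k. 2 * (c - 3/2) * (A' k / 4 ^ k) * z ^ (2 * k))
        = 2 * (c - 3/2) * (\<Sum>k. A' k / 4 ^ k * z ^ (2 * k))"
      using suminf_mult[OF A', of "2 * (c - 3/2)"] by (simp only: mult.assoc)
    ultimately show ?thesis
      by (simp only: coeff)
  qed
  also have "\<dots> = z powr (1/2) * (c - 3/2) * spherical_bessel4 b c \<rho> (\<nu> - 1) z"
  proof -
    have "z powr (\<nu> - 1/2) = z powr (1/2) * z powr (\<nu> - 1)"
      by (simp add: algebra_simps flip: powr_add)
    moreover have "(2::complex) powr (1 - \<nu>) = 2 * 2 powr (- \<nu>)"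
      by (simp add: powr_diff powr_minus divide_inverse)
    ultimately show ?thesis
      using spherical_bessel4_eq[OF \<rho> z, of b c "\<nu> - 1"] by (simp add: K_def A'_def)
  qed
  finally show "((\<lambda>w. w powr (- \<nu> + 1/2) * deriv F w) has_field_derivative
           z powr (1/2) * (c - 3/2) * spherical_bessel4 b c \<rho> (\<nu> - 1) z) (at z)"
    using D(2)[of "- \<nu> + 1/2"] by simp
qed

text \<open>Here \<open>\<alpha> = \<nu>\<close> and \<open>\<beta> = 1 - \<nu>/2\<close>, so the factors are \<open>\<nu> + k\<close> and \<open>(\<nu> + 2k)/2\<close>; the latter
  is the source of the 2 in \<open>(l - 1)/2\<close>.\<close>

lemma bessel_clifford4_order_lowering:
  fixes b l \<nu> :: complex
  assumes \<rho>: "Re \<rho> \<ge> 0" and z: "z \<notin> \<real>\<^sub>\<le>\<^sub>0"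
  defines "F \<equiv> \<lambda>w. csqrt w powr (2 * \<nu>) * bessel_clifford4 b (l - 1) \<rho> \<nu> w"
  shows "F field_differentiable at z"
    and "((\<lambda>w. csqrt w powr (- \<nu> + 2) * deriv F w) has_field_derivative
           csqrt z powr (\<nu> - 2) * ((l - 1) / 2) * bessel_clifford4 b l \<rho> (\<nu> - 1) z) (at z)"
proof -
  define A where "A = bessel4_coeff b (l - 1) \<rho> \<nu>"
  define A' where "A' = bessel4_coeff b l \<rho> (\<nu> - 1)"
  have z0: "z \<noteq> 0" using z by auto
  have A: "summable (\<lambda>k. A k * x ^ k)" and A': "summable (\<lambda>k. A' k * x ^ k)" for x
    unfolding A_def A'_def by (rule summable_bessel4_coeff[OF \<rho>])+
  have F: "F w = 1 * (w powr \<nu> * (\<Sum>k. A k * w ^ (1 * k)))" if "w \<notin> \<real>\<^sub>\<le>\<^sub>0" for w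
  proof -
    have "w \<noteq> 0" using that by auto
    then show ?thesis
      using bessel_clifford4_eq[OF \<rho>] by (simp add: F_def A_def csqrt_powr)
  qed
  note D = iterated_derivative_powr_times_power_series[where a = A, OF A z F]
  show "F field_differentiable at z" by (rule D(1))
  have coeff: "(\<nu> + (- \<nu> + 2) / 2 - 1 + of_nat (1 * k)) * ((\<nu> + of_nat (1 * k)) * A k)
       = (l - 1) / 2 * A' k" for k
  proof -
    have outer: "\<nu> + (- \<nu> + 2) / 2 - 1 + of_nat (1 * k) = (\<nu> + 2 * of_nat k) / 2"
      by (simp add: field_simps)
    have lower: "(\<nu> + of_nat k) * (\<nu> + 2 * of_nat k) * A k = (l - 1) * A' k"
      unfolding A_def A'_def by (rule bessel4_coeff_lower_order)
    have "(\<nu> + 2 * of_nat k) / 2 * ((\<nu> + of_nat k) * A k)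
        = (\<nu> + of_nat k) * (\<nu> + 2 * of_nat k) * A k / 2"
      by (simp only: mult_ac times_divide_eq_right times_divide_eq_left)
    then show ?thesis
      unfolding outer lower by simp
  qed
  have "1 * (z powr (\<nu> + (- \<nu> + 2) / 2 - 2) *
      (\<Sum>k. (\<nu> + (- \<nu> + 2) / 2 - 1 + of_nat (1 * k)) * ((\<nu> + of_nat (1 * k)) * A k) * z ^ (1 * k)))
    = z powr ((\<nu> - 2) / 2) * ((l - 1) / 2 * (\<Sum>k. A' k * z ^ k))"
    unfolding coeff using suminf_mult[OF A', of "(l - 1) / 2"]
    by (simp add: mult.assoc diff_divide_distrib add_divide_distrib)
  also have "\<dots> = csqrt z powr (\<nu> - 2) * ((l - 1) / 2) * bessel_clifford4 b l \<rho> (\<nu> - 1) z"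
    using bessel_clifford4_eq[OF \<rho> z0] by (simp add: csqrt_powr A'_def)
  finally show "((\<lambda>w. csqrt w powr (- \<nu> + 2) * deriv F w) has_field_derivative
           csqrt z powr (\<nu> - 2) * ((l - 1) / 2) * bessel_clifford4 b l \<rho> (\<nu> - 1) z) (at z)"
    using D(2)[of "(- \<nu> + 2) / 2"] unfolding csqrt_powr[of _ "- \<nu> + 2"] by metis
qed

theorem theorem6p9:
  fixes b \<rho> z :: complex
  assumes "Re \<rho> > 0" and "z \<notin> \<real>\<^sub>\<le>\<^sub>0"
  shows
    "(\<forall>\<nu> c :: complex. Re \<nu> > - 3/2 \<and> Re c > 1/2 \<longrightarrow>
        (\<lambda>w. w powr (\<nu> + 1) * spherical_bessel4 b (c - 1) \<rho> \<nu> w) field_differentiable at z \<and>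
        ((\<lambda>w. w powr (- \<nu> + 1/2)
               * deriv (\<lambda>u. u powr (\<nu> + 1) * spherical_bessel4 b (c - 1) \<rho> \<nu> u) w)
         has_field_derivative
           z powr (1/2) * (c - 3/2) * spherical_bessel4 b c \<rho> (\<nu> - 1) z) (at z)) \<and>
     (\<forall>\<nu> l :: complex. Re \<nu> > - 1 \<and> Re l > 0 \<longrightarrow>
        (\<lambda>w. csqrt w powr (2 * \<nu>) * bessel_clifford4 b (l - 1) \<rho> \<nu> w) field_differentiable at z \<and>
        ((\<lambda>w. csqrt w powr (- \<nu> + 2)
               * deriv (\<lambda>u. csqrt u powr (2 * \<nu>) * bessel_clifford4 b (l - 1) \<rho> \<nu> u) w)
         has_field_derivative
           csqrt z powr (\<nu> - 2) * ((l - 1) / 2) * bessel_clifford4 b l \<rho> (\<nu> - 1) z) (at z))"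
  using spherical_bessel4_order_lowering[of \<rho> z] bessel_clifford4_order_lowering[of \<rho> z] assms
  by simp

end
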